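(* Let $\ell,k$ be positive integers and $N$ an integer, and let $\sigma=p_1\cdots p_k$, where $p_1,\dots,p_k$ are independent, each uniformly random among the $(N-1)!$ cycles of length $N$ in $S_N$. Let $p(N,\ell;k)$ be the probability that $\sigma$ blocks the elements of $[\ell]=\{1,\dots,\ell\}$. Then \[ p(N,\ell;k)=\frac{\binom{N-\ell}{\ell}}{\binom{N}{\ell}}+(-1)^{k+1}\frac{\binom{N-\ell-1}{\ell-1}}{(N-1)^{k-1}\binom{N}{\ell}}. \]
   Context: Two elements $x,y$ are neighbors in a permutation $s$ if they are consecutive in a cycle of $s$, i.e. $y=s(x)$ or $x=s(y)$. A permutation $s$ of $[N]$ blocks the elements of $[\ell]$ if in every cycle of $s$ (1) no two elements of $[\ell]$ are neighbors, and (2) each element of $[\ell]$ has a neighbor from $[N]\setminus[\ell]$. *)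

theory Defs
  imports "HOL-Combinatorics.Combinatorics" "HOL-Probability.Probability"
begin

text \<open>
  The set \<open>[m]\<close> is \<open>{1..m}\<close>, and a permutation of \<open>[N]\<close> is a function on \<open>nat\<close> that
  permutes \<open>{1..N}\<close>, i.e. is the identity elsewhere.
\<close>

definition full_cycles :: "nat \<Rightarrow> (nat \<Rightarrow> nat) set" where
  "full_cycles N = {cycle_of_list cs | cs. distinct cs \<and> set cs = {1..N}}"

lemma full_cycles_permutes:
  assumes "s \<in> full_cycles N"
  shows "s permutes {1..N}"
proof -
  obtain cs where "s = cycle_of_list cs" "set cs = {1..N}"
    using assms unfolding full_cycles_def by blast
  then show ?thesis
    using cycle_permutes[of cs] by simp
qed

lemma finite_full_cycles: "finite (full_cycles N)"
  by (rule finite_subset[OF _ finite_permutations[OF finite_atLeastAtMost[of 1 N]]])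
     (use full_cycles_permutes in blast)

lemma full_cycles_nonempty: "full_cycles N \<noteq> {}"
  using finite_distinct_list[of "{1..N}"] by (auto simp: full_cycles_def)

definition neighbors :: "(nat \<Rightarrow> nat) \<Rightarrow> nat \<Rightarrow> nat \<Rightarrow> bool" where
  "neighbors s x y \<longleftrightarrow> y = s x \<or> x = s y"

text \<open>
  Neighbors always lie in the same cycle of \<open>s\<close>, so ``in every cycle'' needs no separate
  quantifier. A fixed point of \<open>s\<close> in \<open>[l]\<close> violates the second condition.
\<close>

definition blocks :: "nat \<Rightarrow> nat \<Rightarrow> (nat \<Rightarrow> nat) \<Rightarrow> bool" where
  "blocks N l s \<longleftrightarrow>
     (\<forall>x\<in>{1..l}. \<forall>y\<in>{1..l}. x \<noteq> y \<longrightarrow> \<not> neighbors s x y) \<and>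
     (\<forall>x\<in>{1..l}. \<exists>y\<in>{1..N} - {1..l}. neighbors s x y)"

text \<open>
  \<open>replicate_pmf k\<close> draws \<open>k\<close> independent samples \<open>[p\<^sub>1, \<dots>, p\<^sub>k]\<close>; the fold forms the product
  \<open>p\<^sub>1 \<circ> \<dots> \<circ> p\<^sub>k\<close>.
\<close>

definition cycle_product_pmf :: "nat \<Rightarrow> nat \<Rightarrow> (nat \<Rightarrow> nat) pmf" where
  "cycle_product_pmf N k =
     map_pmf (\<lambda>ps. foldr (\<circ>) ps id) (replicate_pmf k (pmf_of_set (full_cycles N)))"

definition block_prob :: "nat \<Rightarrow> nat \<Rightarrow> nat \<Rightarrow> real" where
  "block_prob N l k = measure_pmf.prob (cycle_product_pmf N k) {s. blocks N l s}"

text \<open>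
  Binomial coefficient with the convention that it vanishes for a negative upper argument. Only
  the upper argument \<open>N - l - 1 = -1\<close>, for \<open>l = N\<close>, is affected; there the value
  \<open>(-1) ^ (l - 1)\<close> of \<open>gchoose\<close> would be wrong, since \<open>[N]\<close> is never blocked in \<open>S\<^sub>N\<close>.
\<close>

definition binom :: "int \<Rightarrow> nat \<Rightarrow> nat" where
  "binom n r = (if n < 0 then 0 else nat n choose r)"

end

theory Submission
  imports Defs
begin

section \<open>Cycles through all elements of a finite set\<close>

text \<open>Let \<open>A = {1..l}\<close>. A permutation s of [N] blocks [l] exactly when s(A) and A
  are disjoint (\<open>blocks_iff_image_disjoint\<close>), so only the image of A matters. Split off
  one uniform cycle p, write the product as p o t with t the product of the other k - 1 cycles, and
  condition on C = t(A).

  The key count is \<open>card_cycles_on_image_eq\<close>: for B of the same size l as C, the number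
  of N-cycles carrying C onto B is |C - B| (l-1)! (N-l-1)!. It depends on B only through |C - B|,
  and linearly. Summing over the l-subsets B of [N] - A shows that p(C) misses A with a probability
  affine in |C - A| (\<open>card_cycles_on_image_disjoint\<close>). Hence only the mean of |t(A) -
  A| is needed, not its distribution.

  Since p x is uniform on the points other than x, the mean of |p(C) - A| is again affine in |C -
  A|, now with slope -1/(N-1). So the means of |t(A) - A| satisfy an affine recurrence starting at 0
  (\<open>expectation_card_image_diff\<close>). Its fixed point yields the first term of the
  formula, and the power (-1/(N-1))^(k-1) yields the second.\<close>

text \<open>The ground set is arbitrary, not \<open>{1..N}\<close>, because the inductions below
  delete points from it.\<close>

definition cycles_on :: "'a set \<Rightarrow> ('a \<Rightarrow> 'a) set" where
  "cycles_on S = {cycle_of_list cs | cs. distinct cs \<and> set cs = S}"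

lemma cycles_on_permutes: "p \<in> cycles_on S \<Longrightarrow> p permutes S"
  using cycle_permutes unfolding cycles_on_def by blast

lemma finite_cycles_on: "finite S \<Longrightarrow> finite (cycles_on S)"
  using cycles_on_permutes by (blast intro: finite_subset[OF _ finite_permutations])

lemma cycles_onE_Cons:
  assumes "p \<in> cycles_on S" "w \<in> S"
  obtains cs where "p = cycle_of_list (w # cs)" "distinct (w # cs)" "set (w # cs) = S"
proof -
  from assms(1) obtain ds where ds: "p = cycle_of_list ds" "distinct ds" "set ds = S"
    unfolding cycles_on_def by blast
  with assms(2) obtain xs ys where split: "ds = xs @ w # ys"
    by (metis split_list)
  have rot: "rotate (length xs) ds = w # (ys @ xs)"
    unfolding split by (simp add: rotate_append)
  show thesis
  proof (rule that)
    show "p = cycle_of_list (w # (ys @ xs))"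
      using cycle_of_list_rotate_independent[OF ds(2)] ds(1) rot by metis
    show "distinct (w # (ys @ xs))" "set (w # (ys @ xs)) = S"
      using ds split by auto
  qed
qed

text \<open>Deleting z from the cycle (z w ...) leaves the cycle (w ...). Conversely q fixes z, so w
  is recovered as the image of z. If S were \<open>{z}\<close>, there would be no w in front of
  which to insert z.\<close>

lemma bij_betw_insert_cycle:
  assumes "z \<in> S" "S \<noteq> {z}"
  shows "bij_betw (\<lambda>(w, q). Transposition.transpose z w \<circ> q)
    ((S - {z}) \<times> cycles_on (S - {z})) (cycles_on S)"
proof (rule bij_betwI')
  fix a b assume a: "a \<in> (S - {z}) \<times> cycles_on (S - {z})" and b: "b \<in> (S - {z}) \<times> cycles_on (S - {z})"
  obtain w q v r where wq: "a = (w, q)" "b = (v, r)" by fastforce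
  have perms: "q permutes S - {z}" "r permutes S - {z}"
    using a b cycles_on_permutes unfolding wq by auto
  then have fix_z: "q z = z" "r z = z"
    by (auto simp: permutes_def)
  have inj: "w = v \<and> q = r" if eq: "Transposition.transpose z w \<circ> q = Transposition.transpose z v \<circ> r"
  proof
    show wv: "w = v"
      using fun_cong[OF eq, of z] fix_z by simp
    have "Transposition.transpose z w \<circ> (Transposition.transpose z w \<circ> q) =
        Transposition.transpose z w \<circ> (Transposition.transpose z w \<circ> r)"
      using eq wv by simp
    then show "q = r"
      by (simp add: fun_eq_iff)
  qed
  show "((case a of (w, q) \<Rightarrow> Transposition.transpose z w \<circ> q) =
      (case b of (w, q) \<Rightarrow> Transposition.transpose z w \<circ> q)) = (a = b)"
    unfolding wq using inj by auto
next
  fix a assume "a \<in> (S - {z}) \<times> cycles_on (S - {z})"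
  then obtain w q where wq: "a = (w, q)" "w \<in> S - {z}" "q \<in> cycles_on (S - {z})" by auto
  obtain cs where cs: "q = cycle_of_list (w # cs)" "distinct (w # cs)" "set (w # cs) = S - {z}"
    using cycles_onE_Cons[OF wq(3,2)] .
  have "Transposition.transpose z w \<circ> q = cycle_of_list (z # w # cs)" "distinct (z # w # cs)" "set (z # w # cs) = S"
    using cs assms(1) by auto
  then show "(case a of (w, q) \<Rightarrow> Transposition.transpose z w \<circ> q) \<in> cycles_on S"
    unfolding cycles_on_def wq prod.case by blast
next
  fix p assume "p \<in> cycles_on S"
  then obtain ds where ds: "p = cycle_of_list (z # ds)" "distinct (z # ds)" "set (z # ds) = S"
    using cycles_onE_Cons[OF _ assms(1)] by metis
  with assms(2) obtain w cs where ds': "ds = w # cs"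
    by (cases ds) auto
  have "cycle_of_list (w # cs) \<in> cycles_on (S - {z})"
    using ds ds' unfolding cycles_on_def by (intro CollectI exI[of _ "w # cs"]) auto
  moreover have "w \<in> S - {z}"
    using ds ds' by auto
  ultimately show "\<exists>a\<in>(S - {z}) \<times> cycles_on (S - {z}). p = (case a of (w, q) \<Rightarrow> Transposition.transpose z w \<circ> q)"
    using ds(1) ds' by (intro bexI[of _ "(w, cycle_of_list (w # cs))"]) auto
qed

text \<open>By the insertion bijection, each deleted point contributes a factor
  \<open>card S - 1\<close>.\<close>

lemma card_cycles_on:
  assumes "finite S"
  shows "card (cycles_on S) = fact (card S - 1)"
  using assms
proof (induction S rule: finite_psubset_induct)
  case (psubset S)
  show ?case
  proof (cases "S = {} \<or> (\<exists>z. S = {z})")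
    case True
    \<comment> \<open>For empty S the truncated \<open>card S - 1\<close> is 0, so the factorial 1
      agrees with the one cycle given by the empty list.\<close>
    then have "cycles_on S = {id}"
    proof
      assume "S = {}"
      then show ?thesis by (auto simp: cycles_on_def)
    next
      assume "\<exists>z. S = {z}"
      then obtain z where z: "S = {z}" by blast
      have "p = id" if "p \<in> cycles_on S" for p
        using cycles_on_permutes[OF that] z by simp
      moreover have "id \<in> cycles_on S"
        unfolding cycles_on_def z by (intro CollectI exI[of _ "[z]"]) simp
      ultimately show ?thesis by blast
    qed
    then show ?thesis using True by auto
  next
    case False
    then obtain z where z: "z \<in> S" "S \<noteq> {z}" by blast
    then have "S - {z} \<noteq> {}" by blast
    then have pos: "card (S - {z}) > 0" using psubset.hyps by (simp add: card_gt_0_iff)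
    have "card (cycles_on S) = card (S - {z}) * card (cycles_on (S - {z}))"
      using bij_betw_same_card[OF bij_betw_insert_cycle[OF z]] by (simp add: card_cartesian_product)
    also have "card (cycles_on (S - {z})) = fact (card (S - {z}) - 1)"
      by (rule psubset.IH) (use z in blast)
    also have "card (S - {z}) * fact (card (S - {z}) - 1) = fact (card (S - {z}))"
      using pos by (simp add: fact_reduce)
    finally show ?thesis using z psubset.hyps by simp
  qed
qed

section \<open>Counting the cycles with a prescribed image of a set\<close>

text \<open>If A = B both sides vanish, since a single cycle has no proper nonempty invariant set.
  Otherwise delete a point z of B - A: with p = (z w) q, the condition becomes that w is outside B
  and q maps A onto B with z replaced by w. Summing the smaller counts over w supplies the missing
  factor of the factorial.\<close>

lemma card_cycles_on_image_eq:
  assumes "finite S" "A \<subseteq> S" "B \<subseteq> S" "card A = card B" "A \<noteq> {}" "A \<noteq> S"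
  shows "card {p \<in> cycles_on S. p ` A = B} =
    card (A - B) * fact (card A - 1) * fact (card S - card A - 1)"
  using assms
proof (induction S arbitrary: B rule: finite_psubset_induct)
  case (psubset S)
  have finA: "finite A" and finB: "finite B"
    using psubset.prems psubset.hyps finite_subset by auto
  show ?case
  proof (cases "A = B")
    case True
    have "p ` A \<noteq> A" if p: "p \<in> cycles_on S" for p
    proof
      assume inv: "p ` A = A"
      obtain w where w: "w \<in> A" using \<open>A \<noteq> {}\<close> by blast
      have inA: "(p ^^ n) x \<in> A" if "x \<in> A" for n x
        using inv that by (induction n) auto
      have "y \<in> A" if y: "y \<in> S" for y
      proof -
        obtain ds where ds: "p = cycle_of_list (w # ds)" "distinct (w # ds)" "set (w # ds) = S"
          using cycles_onE_Cons[OF p, of w] w psubset.prems(1) by (metis subsetD)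
        obtain i where i: "i < length (w # ds)" "y = (w # ds) ! i"
          using y unfolding ds(3)[symmetric] in_set_conv_nth by blast
        \<comment> \<open>Applying p i times rotates the list by i places, so the orbit of w runs
          through all of S.\<close>
        have "(p ^^ i) w = hd (map (p ^^ i) (w # ds))"
          by (simp only: list.map list.sel)
        also have "\<dots> = hd (rotate i (w # ds))"
          using cyclic_rotation[OF ds(2), of i] ds(1) by (simp only:)
        also have "\<dots> = (w # ds) ! i"
          using i hd_rotate_conv_nth[of "w # ds" i] by (simp only: mod_less) simp
        finally show ?thesis using inA[OF w, of i] i by (simp only:)
      qed
      then show False using \<open>A \<subseteq> S\<close> \<open>A \<noteq> S\<close> by blast
    qed
    then have none: "{p \<in> cycles_on S. p ` A = B} = {}" using True by blast
    show ?thesis unfolding none using True by simp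
  next
    case False
    then have "\<not> B \<subseteq> A"
      using card_subset_eq[OF finA] psubset.prems by metis
    then obtain z where zB: "z \<in> B" and zA: "z \<notin> A" by blast
    then have zS: "z \<in> S" using psubset.prems by blast
    have nz: "S \<noteq> {z}" using psubset.prems zA by blast
    let ?T = "S - {z}"
    have finT: "finite ?T" using psubset.hyps by blast
    have AT: "A \<subseteq> ?T" using psubset.prems zA by blast
    \<comment> \<open>For w outside B, this is the image of B under the transposition of z and
      w.\<close>
    define C where "C w = insert w (B - {z})" for w
    have trans_image: "(Transposition.transpose z w \<circ> q) ` A = B \<longleftrightarrow> w \<notin> B \<and> q ` A = C w"
      if w: "w \<in> ?T" and q: "q \<in> cycles_on ?T" for w q
    proof -
      have sub: "q ` A \<subseteq> ?T"
        using permutes_image[OF cycles_on_permutes[OF q]] AT by blast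
      have invol: "Transposition.transpose z w ` Transposition.transpose z w ` X = X" for X
        by (simp add: image_image)
      have "(Transposition.transpose z w \<circ> q) ` A = B \<longleftrightarrow> q ` A = Transposition.transpose z w ` B"
        unfolding image_comp[symmetric] by (metis invol)
      \<comment> \<open>This excludes w in B, because q maps A into \<open>?T\<close>, which does
        not contain z.\<close>
      moreover have "z \<in> Transposition.transpose z w ` B" if "w \<in> B"
        using image_eqI[of z "Transposition.transpose z w" w, OF _ that] by simp
      moreover have "Transposition.transpose z w ` B = C w" if "w \<notin> B"
      proof -
        have "Transposition.transpose z w ` B = Transposition.transpose z w ` insert z (B - {z})"
          using zB by (simp add: insert_absorb)
        also have "\<dots> = insert w (Transposition.transpose z w ` (B - {z}))"
          by (simp only: image_insert transpose_apply_first)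
        also have "Transposition.transpose z w ` (B - {z}) = id ` (B - {z})"
          using that by (intro image_cong) (auto simp: Transposition.transpose_def)
        finally show ?thesis unfolding C_def by simp
      qed
      ultimately show ?thesis using sub by blast
    qed
    have "card {p \<in> cycles_on S. p ` A = B} =
      card {x \<in> ?T \<times> cycles_on ?T. (case x of (w, q) \<Rightarrow> Transposition.transpose z w \<circ> q) ` A = B}"
      by (rule sym, rule bij_betw_same_card, rule bij_betw_Collect[OF bij_betw_insert_cycle[OF zS nz]]) simp
    also have "{x \<in> ?T \<times> cycles_on ?T. (case x of (w, q) \<Rightarrow> Transposition.transpose z w \<circ> q) ` A = B} =
      (SIGMA w : S - B. {q \<in> cycles_on ?T. q ` A = C w})"
    proof (rule set_eqI)
      fix x :: "'a \<times> ('a \<Rightarrow> 'a)"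
      obtain w q where "x = (w, q)" by fastforce
      then show "x \<in> {x \<in> ?T \<times> cycles_on ?T. (case x of (w, q) \<Rightarrow> Transposition.transpose z w \<circ> q) ` A = B} \<longleftrightarrow>
          x \<in> (SIGMA w : S - B. {q \<in> cycles_on ?T. q ` A = C w})"
        using trans_image[of w q] zB by (simp only: mem_Collect_eq mem_Sigma_iff prod.case) blast
    qed
    also have "card \<dots> = (\<Sum>w\<in>S - B. card {q \<in> cycles_on ?T. q ` A = C w})"
      using psubset.hyps finite_cycles_on[OF finT] by (intro card_SigmaI) auto
    finally have count: "card {p \<in> cycles_on S. p ` A = B} =
      (\<Sum>w\<in>S - B. card {q \<in> cycles_on ?T. q ` A = C w})" .
    have subC: "C w \<subseteq> ?T" if "w \<in> S - B" for w
      using that zB psubset.prems by (auto simp: C_def)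
    have cardC: "card (C w) = card A" if "w \<in> S - B" for w
      using that card_Suc_Diff1[OF finB zB] finB psubset.prems by (simp add: C_def)
    have cardA: "card A > 0" using \<open>A \<noteq> {}\<close> finA by (simp only: card_gt_0_iff simp_thms)
    have cardSB: "card (S - B) = card S - card A"
      using psubset.prems finB by (simp add: card_Diff_subset)
    show ?thesis
    \<comment> \<open>The induction hypothesis needs A to be a proper subset of \<open>?T\<close>.
      If A is all of \<open>?T\<close>, then every q maps A onto itself and a single w
      remains.\<close>
    proof (cases "A = ?T")
      case True
      then have cS: "card S = Suc (card A)"
        using zS psubset.hyps by (metis card_Suc_Diff1)
      have "C w = A" if "w \<in> S - B" for w
        using card_subset_eq[OF finT subC[OF that]] cardC[OF that] True by simp
      then have "card {q \<in> cycles_on ?T. q ` A = C w} = fact (card A - 1)" if "w \<in> S - B" for w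
      proof -
        have "{q \<in> cycles_on ?T. q ` A = C w} = cycles_on ?T"
          using \<open>\<And>w. w \<in> S - B \<Longrightarrow> C w = A\<close>[OF that] True
            permutes_image[OF cycles_on_permutes] by blast
        then show ?thesis using card_cycles_on[OF finT] True by simp
      qed
      then have "card {p \<in> cycles_on S. p ` A = B} = fact (card A - 1)"
        unfolding count using cardSB cS by simp
      moreover have "A - B = S - B" using True zB by auto
      ultimately show ?thesis using cardSB cS by simp
    next
      case False
      have IH: "card {q \<in> cycles_on ?T. q ` A = C w} =
        card (A - C w) * (fact (card A - 1) * fact (card ?T - card A - 1))" if "w \<in> S - B" for w
        using psubset.IH[of ?T "C w"] AT subC[OF that] cardC[OF that] psubset.prems False zS
        by (auto simp: mult.assoc)
      \<comment> \<open>As z is not in A, \<open>A - C w\<close> is \<open>A - B\<close> without w: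
        one point is lost exactly when w lies in A. Adding \<open>card (A - B)\<close> makes up for
        these losses without natural-number subtraction.\<close>
      have "(\<Sum>w\<in>S - B. card (A - C w)) + card (A - B)
          = (\<Sum>w\<in>S - B. card (A - C w)) + (\<Sum>w\<in>S - B. if w \<in> A then 1 else 0)"
      proof -
        have "(S - B) \<inter> A = A - B" using psubset.prems by blast
        then show ?thesis using psubset.hyps by (simp add: sum.If_cases)
      qed
      also have "\<dots> = (\<Sum>w\<in>S - B. card (A - B))"
      proof -
        have "card (A - C w) + (if w \<in> A then 1 else 0) = card (A - B)" if "w \<in> S - B" for w
        proof -
          have "A - C w = A - B - {w}" unfolding C_def using zA by blast
          then show ?thesis
            using that finA card_Suc_Diff1[of "A - B" w] by auto
        qed
        then show ?thesis by (simp flip: sum.distrib)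
      qed
      finally have tot: "(\<Sum>w\<in>S - B. card (A - C w)) = (card S - card A - 1) * card (A - B)"
        using cardSB by (simp add: diff_mult_distrib)
      have "card A < card ?T" using AT False finT by (simp add: psubset_card_mono psubset_eq)
      then have lt: "card S - card A - 1 > 0" using zS by (simp add: card_Diff_singleton)
      have cT: "card ?T - card A - 1 = card S - card A - 1 - 1"
        using zS by simp
      have "card {p \<in> cycles_on S. p ` A = B} =
        (card S - card A - 1) * card (A - B) * (fact (card A - 1) * fact (card S - card A - 1 - 1))"
        unfolding count tot[symmetric] sum_distrib_right using IH cT by (intro sum.cong) auto
      also have "\<dots> = card (A - B) * fact (card A - 1) *
          ((card S - card A - 1) * fact (card S - card A - 1 - 1))"
        by (simp only: mult_ac)
      also have "(card S - card A - 1) * fact (card S - card A - 1 - 1) = fact (card S - card A - 1)"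
        using lt by (metis fact_reduce of_nat_id)
      finally show ?thesis .
    qed
  qed
qed

text \<open>The image count for singletons, where the factor \<open>card ({x} - {y})\<close>
  vanishes exactly for x = y.\<close>

lemma card_cycles_on_apply_eq:
  assumes "finite S" "x \<in> S" "y \<in> S" "card S \<ge> 2"
  shows "card {p \<in> cycles_on S. p x = y} = (if x = y then 0 else fact (card S - 2))"
proof -
  have "{x} \<noteq> S" using assms by auto
  moreover have "{p \<in> cycles_on S. p x = y} = {p \<in> cycles_on S. p ` {x} = {y}}" by auto
  ultimately show ?thesis
    using card_cycles_on_image_eq[of S "{x}" "{y}"] assms
    by (simp add: numeral_2_eq_2)
qed

section \<open>Averages over one cycle\<close>

text \<open>Double counting of the triples p, x in C, y in S - A with p x = y. Each pair with x
  different from y occurs for (|S|-2)! cycles. The pairs with x = y, one for each element of C - A,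
  never occur; they are the origin of the negative slope.\<close>

lemma sum_card_image_diff_cycles_on:
  assumes "finite S" "A \<subseteq> S" "C \<subseteq> S" "card S \<ge> 2"
  shows "(\<Sum>p\<in>cycles_on S. real (card (p ` C - A))) =
    fact (card S - 2) * (real (card C) * real (card S - card A) - real (card (C - A)))"
proof -
  have finC: "finite C" and finA: "finite A" using assms finite_subset by auto
  have fin: "finite (cycles_on S)" using assms finite_cycles_on by blast
  have each: "real (card (p ` C - A)) = (\<Sum>x\<in>C. \<Sum>y\<in>S - A. of_bool (p x = y))"
    if p: "p \<in> cycles_on S" for p
  proof -
    note perm = cycles_on_permutes[OF p]
    have "p ` C - A = p ` {x \<in> C. p x \<notin> A}" by blast
    then have "card (p ` C - A) = card {x \<in> C. p x \<notin> A}"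
      using card_image[OF inj_on_subset[OF permutes_inj[OF perm]]] by simp
    also have "real \<dots> = (\<Sum>x\<in>C. of_bool (p x \<notin> A))"
      using finC by (simp add: sum.If_cases of_bool_def Int_def)
    also have "\<dots> = (\<Sum>x\<in>C. \<Sum>y\<in>S - A. of_bool (p x = y))"
    proof (intro sum.cong refl)
      fix x assume "x \<in> C"
      then have "p x \<in> S" using assms permutes_in_image[OF perm] by blast
      then show "of_bool (p x \<notin> A) = (\<Sum>y\<in>S - A. of_bool (p x = y) :: real)"
        using assms by (simp add: of_bool_def)
    qed
    finally show ?thesis .
  qed
  have "(\<Sum>p\<in>cycles_on S. real (card (p ` C - A))) =
    (\<Sum>p\<in>cycles_on S. \<Sum>x\<in>C. \<Sum>y\<in>S - A. of_bool (p x = y))"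
    using each by simp
  also have "\<dots> = (\<Sum>x\<in>C. \<Sum>y\<in>S - A. \<Sum>p\<in>cycles_on S. of_bool (p x = y))"
    by (subst sum.swap, intro sum.cong refl, subst sum.swap, rule refl)
  also have "\<dots> = (\<Sum>x\<in>C. \<Sum>y\<in>S - A. real (card {p \<in> cycles_on S. p x = y}))"
    using fin by (simp add: sum.If_cases of_bool_def Int_def)
  also have "\<dots> = (\<Sum>x\<in>C. \<Sum>y\<in>S - A. fact (card S - 2) * (1 - of_bool (x = y)))"
    using assms by (intro sum.cong refl) (auto simp: card_cycles_on_apply_eq subset_iff)
  also have "\<dots> = (\<Sum>x\<in>C. fact (card S - 2) * (real (card (S - A)) - of_bool (x \<notin> A)))"
  proof (intro sum.cong refl)
    fix x assume "x \<in> C"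
    then have "(\<Sum>y\<in>S - A. of_bool (x = y) :: real) = of_bool (x \<notin> A)"
      using assms by (auto simp: of_bool_def)
    then show "(\<Sum>y\<in>S - A. fact (card S - 2) * (1 - of_bool (x = y))) =
        fact (card S - 2) * (real (card (S - A)) - of_bool (x \<notin> A))"
      by (simp flip: sum_distrib_left add: sum_subtractf)
  qed
  also have "\<dots> = fact (card S - 2) * (real (card C) * real (card (S - A)) - (\<Sum>x\<in>C. of_bool (x \<notin> A)))"
    by (simp flip: sum_distrib_left add: sum_subtractf)
  also have "(\<Sum>x\<in>C. of_bool (x \<notin> A)) = real (card (C - A))"
    using finC by (simp add: sum.If_cases of_bool_def Int_def set_diff_eq)
  also have "card (S - A) = card S - card A"
    using assms finA by (simp add: card_Diff_subset)
  finally show ?thesis .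
qed

text \<open>Exchange the sums: a point x of U lies in as many l-subsets of U as there are
  (l-1)-subsets of \<open>U - {x}\<close>, and a point outside U lies in none.\<close>

lemma sum_card_diff_subsets:
  assumes "finite U" "finite C" "l \<ge> 1"
  shows "(\<Sum>B | B \<subseteq> U \<and> card B = l. real (card (C - B))) =
    real (card C) * real (card U choose l) - real (card (C \<inter> U)) * real ((card U - 1) choose (l - 1))"
proof -
  let ?F = "{B. B \<subseteq> U \<and> card B = l}"
  have finF: "finite ?F" using assms by simp
  have "(\<Sum>B\<in>?F. real (card (C - B))) = (\<Sum>B\<in>?F. \<Sum>x\<in>C. 1 - of_bool (x \<in> B))"
  proof (intro sum.cong refl)
    fix B
    have "(\<Sum>x\<in>C. 1 - of_bool (x \<in> B) :: real) = (\<Sum>x\<in>C. of_bool (x \<notin> B))"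
      by (intro sum.cong) auto
    then show "real (card (C - B)) = (\<Sum>x\<in>C. 1 - of_bool (x \<in> B))"
      using assms by (simp add: sum.If_cases of_bool_def Int_def set_diff_eq)
  qed
  also have "\<dots> = (\<Sum>x\<in>C. \<Sum>B\<in>?F. 1 - of_bool (x \<in> B))"
    by (rule sum.swap)
  also have "\<dots> = (\<Sum>x\<in>C. real (card U choose l) - of_bool (x \<in> U) * real ((card U - 1) choose (l - 1)))"
  proof (intro sum.cong refl)
    fix x assume "x \<in> C"
    have "(\<Sum>B\<in>?F. of_bool (x \<in> B) :: real) = real (card {B \<in> ?F. x \<in> B})"
      using finF by (simp add: sum.If_cases of_bool_def Int_def)
    also have "card {B \<in> ?F. x \<in> B} = of_bool (x \<in> U) * ((card U - 1) choose (l - 1))"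
    proof (cases "x \<in> U")
      case True
      have "bij_betw (insert x) {B. B \<subseteq> U - {x} \<and> card B = l - 1} {B \<in> ?F. x \<in> B}"
      proof (rule bij_betw_byWitness[where f' = "\<lambda>B. B - {x}"])
        show "insert x ` {B. B \<subseteq> U - {x} \<and> card B = l - 1} \<subseteq> {B \<in> ?F. x \<in> B}"
        proof
          fix B' assume "B' \<in> insert x ` {B. B \<subseteq> U - {x} \<and> card B = l - 1}"
          then obtain B where B: "B' = insert x B" "B \<subseteq> U - {x}" "card B = l - 1"
            by blast
          then have "finite B" "x \<notin> B"
            using assms finite_subset by auto
          then show "B' \<in> {B \<in> ?F. x \<in> B}"
            using B True assms by auto
        qed
        show "(\<lambda>B. B - {x}) ` {B \<in> ?F. x \<in> B} \<subseteq> {B. B \<subseteq> U - {x} \<and> card B = l - 1}"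
          by (auto simp: card_Diff_singleton)
      qed auto
      then have "card {B \<in> ?F. x \<in> B} = card {B. B \<subseteq> U - {x} \<and> card B = l - 1}"
        by (rule bij_betw_same_card[symmetric])
      then show ?thesis using True assms by (simp add: n_subsets)
    next
      case False
      then have none: "{B \<in> ?F. x \<in> B} = {}" by blast
      show ?thesis unfolding none using False by simp
    qed
    finally show "(\<Sum>B\<in>?F. 1 - of_bool (x \<in> B)) =
        real (card U choose l) - of_bool (x \<in> U) * real ((card U - 1) choose (l - 1))"
      using assms by (simp add: sum_subtractf n_subsets)
  qed
  also have "\<dots> = real (card C) * real (card U choose l)
      - (\<Sum>x\<in>C. of_bool (x \<in> U)) * real ((card U - 1) choose (l - 1))"
    by (simp add: sum_subtractf sum_distrib_right)
  also have "(\<Sum>x\<in>C. of_bool (x \<in> U)) = real (card (C \<inter> U))"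
    using assms by (simp add: sum.If_cases of_bool_def Int_def)
  finally show ?thesis .
qed

text \<open>The image of C misses A exactly when it is some subset B of S - A of size |A|. The image
  count is linear in |C - B|, so its sum over B depends on C only through |C - A|.\<close>

lemma card_cycles_on_image_disjoint:
  assumes "finite S" "A \<subseteq> S" "C \<subseteq> S" "card C = card A" "A \<noteq> {}" "A \<noteq> S"
  shows "real (card {p \<in> cycles_on S. p ` C \<inter> A = {}}) =
    fact (card A - 1) * fact (card S - card A - 1) *
      (real (card A) * real ((card S - card A) choose card A)
        - real (card (C - A)) * real ((card S - card A - 1) choose (card A - 1)))"
proof -
  let ?F = "{B. B \<subseteq> S - A \<and> card B = card A}"
  have finC: "finite C" and finA: "finite A" using assms finite_subset by auto
  have cardA: "card A \<ge> 1" using assms finA by (simp add: Suc_le_eq card_gt_0_iff)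
  have C: "C \<noteq> {}" "C \<noteq> S"
    using assms cardA card_subset_eq[of S A] by auto
  have "{p \<in> cycles_on S. p ` C \<inter> A = {}} = (\<Union>B\<in>?F. {p \<in> cycles_on S. p ` C = B})"
  proof -
    have "p ` C \<in> ?F" if "p \<in> cycles_on S" "p ` C \<inter> A = {}" for p
    proof -
      note perm = cycles_on_permutes[OF that(1)]
      have "p ` C \<subseteq> S" using assms permutes_image[OF perm] by blast
      moreover have "card (p ` C) = card C"
        using card_image[OF inj_on_subset[OF permutes_inj[OF perm]]] by simp
      ultimately show ?thesis using that assms by auto
    qed
    then show ?thesis by blast
  qed
  also have "card \<dots> = (\<Sum>B\<in>?F. card {p \<in> cycles_on S. p ` C = B})"
    using assms finite_cycles_on[of S] by (intro card_UN_disjoint) auto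
  also have "\<dots> = (\<Sum>B\<in>?F. card (C - B) * (fact (card A - 1) * fact (card S - card A - 1)))"
  proof (intro sum.cong refl)
    fix B assume "B \<in> ?F"
    then show "card {p \<in> cycles_on S. p ` C = B} =
        card (C - B) * (fact (card A - 1) * fact (card S - card A - 1))"
      using card_cycles_on_image_eq[of S C B] assms C by (auto simp: mult.assoc)
  qed
  also have "real \<dots> = fact (card A - 1) * fact (card S - card A - 1) * (\<Sum>B\<in>?F. real (card (C - B)))"
    by (simp add: sum_distrib_left sum_distrib_right mult_ac)
  also have "(\<Sum>B\<in>?F. real (card (C - B))) =
      real (card C) * real (card (S - A) choose card A)
        - real (card (C \<inter> (S - A))) * real ((card (S - A) - 1) choose (card A - 1))"
    by (rule sum_card_diff_subsets) (use assms finC cardA in auto)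
  also have "C \<inter> (S - A) = C - A" using assms by blast
  also have "card (S - A) = card S - card A" using assms finA by (simp add: card_Diff_subset)
  finally show ?thesis using assms by simp
qed

section \<open>Products of independent cycles\<close>

lemma full_cycles_eq: "full_cycles N = cycles_on {1..N}"
  by (simp add: full_cycles_def cycles_on_def)

text \<open>\<open>foldr\<close> makes the first sample the outermost factor. Exchanging the
  independent draws allows conditioning on the remaining product t.\<close>

lemma cycle_product_pmf_Suc:
  "cycle_product_pmf N (Suc k) =
    bind_pmf (cycle_product_pmf N k) (\<lambda>t. map_pmf (\<lambda>p. p \<circ> t) (pmf_of_set (full_cycles N)))"
proof -
  have "cycle_product_pmf N (Suc k) =
    bind_pmf (pmf_of_set (full_cycles N)) (\<lambda>p. bind_pmf (cycle_product_pmf N k) (\<lambda>t. return_pmf (p \<circ> t)))"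
    by (simp add: cycle_product_pmf_def map_bind_pmf bind_map_pmf)
  also have "\<dots> = bind_pmf (cycle_product_pmf N k)
      (\<lambda>t. bind_pmf (pmf_of_set (full_cycles N)) (\<lambda>p. return_pmf (p \<circ> t)))"
    by (rule bind_commute_pmf)
  finally show ?thesis by (simp add: map_pmf_def)
qed

lemma cycle_product_pmf_permutes:
  "s \<in> set_pmf (cycle_product_pmf N k) \<Longrightarrow> s permutes {1..N}"
proof (induction k arbitrary: s)
  case 0
  then show ?case by (simp add: cycle_product_pmf_def permutes_id flip: id_def)
next
  case (Suc k)
  then show ?case
    by (auto simp: cycle_product_pmf_Suc set_pmf_of_set[OF full_cycles_nonempty finite_full_cycles]
        intro!: permutes_compose dest: full_cycles_permutes)
qed

lemma finite_set_cycle_product_pmf: "finite (set_pmf (cycle_product_pmf N k))"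
  using cycle_product_pmf_permutes
  by (blast intro: finite_subset[OF _ finite_permutations[OF finite_atLeastAtMost]])

lemma expectation_cycle_product_pmf_Suc:
  fixes f :: "(nat \<Rightarrow> nat) \<Rightarrow> real"
  shows "measure_pmf.expectation (cycle_product_pmf N (Suc k)) f =
    measure_pmf.expectation (cycle_product_pmf N k)
      (\<lambda>t. (\<Sum>p\<in>full_cycles N. f (p \<circ> t)) / fact (N - 1))"
proof -
  note fin = finite_set_cycle_product_pmf[of N k]
  have "card (full_cycles N) = fact (N - 1)"
    by (simp add: full_cycles_eq card_cycles_on)
  then have inner: "measure_pmf.expectation (map_pmf (\<lambda>p. p \<circ> t) (pmf_of_set (full_cycles N))) f =
      (\<Sum>p\<in>full_cycles N. f (p \<circ> t)) / fact (N - 1)" for t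
    using integral_pmf_of_set[OF full_cycles_nonempty finite_full_cycles] by simp
  have "measure_pmf.expectation (cycle_product_pmf N (Suc k)) f =
    (\<Sum>t\<in>set_pmf (cycle_product_pmf N k). pmf (cycle_product_pmf N k) t *\<^sub>R
      measure_pmf.expectation (map_pmf (\<lambda>p. p \<circ> t) (pmf_of_set (full_cycles N))) f)"
    unfolding cycle_product_pmf_Suc
    by (rule pmf_expectation_bind)
       (use fin in \<open>auto simp: set_pmf_of_set[OF full_cycles_nonempty finite_full_cycles] finite_full_cycles\<close>)
  also have "\<dots> = (\<Sum>t\<in>set_pmf (cycle_product_pmf N k). pmf (cycle_product_pmf N k) t *\<^sub>R
      ((\<Sum>p\<in>full_cycles N. f (p \<circ> t)) / fact (N - 1)))"
    by (simp only: inner)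
  also have "\<dots> = measure_pmf.expectation (cycle_product_pmf N k)
      (\<lambda>t. (\<Sum>p\<in>full_cycles N. f (p \<circ> t)) / fact (N - 1))"
    by (rule integral_measure_pmf[symmetric]) (use fin in auto)
  finally show ?thesis .
qed

text \<open>Linearity of expectation; the relation is required only on permutations of [N], which
  carry the whole distribution.\<close>

lemma expectation_affine_cycle_product_pmf:
  fixes f g :: "(nat \<Rightarrow> nat) \<Rightarrow> real"
  assumes "\<And>t. t permutes {1..N} \<Longrightarrow> g t = a - b * f t"
  shows "measure_pmf.expectation (cycle_product_pmf N k) g =
    a - b * measure_pmf.expectation (cycle_product_pmf N k) f"
proof -
  have "measure_pmf.expectation (cycle_product_pmf N k) g =
    measure_pmf.expectation (cycle_product_pmf N k) (\<lambda>t. a - b * f t)"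
    using assms cycle_product_pmf_permutes
    by (intro integral_cong_AE) (auto simp: AE_measure_pmf_iff)
  also have "\<dots> = a - b * measure_pmf.expectation (cycle_product_pmf N k) f"
    by (simp add: integrable_measure_pmf_finite finite_set_cycle_product_pmf)
  finally show ?thesis .
qed

section \<open>The mean number of elements that leave a set\<close>

text \<open>With a = |A|, one more cycle turns the mean E into (a(N-a) - E)/(N-1). This map has
  fixed point a(N-a)/N and ratio -1/(N-1), and the empty product starts it at 0.\<close>

lemma expectation_card_image_diff:
  assumes "A \<subseteq> {1..N}" "N \<ge> 2"
  shows "measure_pmf.expectation (cycle_product_pmf N k) (\<lambda>t. real (card (t ` A - A))) =
    real (card A) * (real N - real (card A)) / real N * (1 - (-1) ^ k / (real N - 1) ^ k)"
proof (induction k)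
  case 0
  show ?case by (simp add: cycle_product_pmf_def)
next
  case (Suc k)
  let ?a = "real (card A)" and ?n = "real N"
  have le: "card A \<le> N" using card_mono[OF _ assms(1)] by simp
  have fact: "fact (N - 1) = (?n - 1) * (fact (N - 2) :: real)"
    using assms(2) fact_reduce[of "N - 1", where 'a = real]
    by (simp add: of_nat_diff numeral_2_eq_2)
  have "measure_pmf.expectation (cycle_product_pmf N (Suc k)) (\<lambda>t. real (card (t ` A - A))) =
    ?a * (?n - ?a) / (?n - 1) - 1 / (?n - 1) *
      measure_pmf.expectation (cycle_product_pmf N k) (\<lambda>t. real (card (t ` A - A)))"
    unfolding expectation_cycle_product_pmf_Suc
  proof (rule expectation_affine_cycle_product_pmf)
    fix t assume t: "t permutes {1..N}"
    have "t ` A \<subseteq> {1..N}" using assms permutes_image[OF t] by blast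
    moreover have "card (t ` A) = card A"
      using card_image[OF inj_on_subset[OF permutes_inj[OF t]]] by simp
    ultimately have "(\<Sum>p\<in>full_cycles N. real (card ((p \<circ> t) ` A - A))) =
        fact (N - 2) * (?a * (?n - ?a) - real (card (t ` A - A)))"
      using sum_card_image_diff_cycles_on[of "{1..N}" A "t ` A"] assms le
      by (simp add: full_cycles_eq image_comp of_nat_diff)
    then show "(\<Sum>p\<in>full_cycles N. real (card ((p \<circ> t) ` A - A))) / fact (N - 1) =
        ?a * (?n - ?a) / (?n - 1) - 1 / (?n - 1) * real (card (t ` A - A))"
      unfolding fact using assms(2) by (simp add: diff_divide_distrib)
  qed
  then show ?case
    unfolding Suc using assms(2) by (simp add: divide_simps) (simp add: algebra_simps)
qed

section \<open>Blocking as disjointness, and the final evaluation\<close>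

text \<open>If x and s x both lie in [l], condition (1) forces s x = x, and then x has no neighbor
  but itself, against (2). Conversely, s x itself is the neighbor outside [l] that (2)
  demands.\<close>

lemma blocks_iff_image_disjoint:
  assumes "s permutes {1..N}" "l \<le> N"
  shows "blocks N l s \<longleftrightarrow> s ` {1..l} \<inter> {1..l} = {}"
proof
  assume b: "blocks N l s"
  show "s ` {1..l} \<inter> {1..l} = {}"
  proof (rule ccontr)
    assume "s ` {1..l} \<inter> {1..l} \<noteq> {}"
    then obtain x where x: "x \<in> {1..l}" "s x \<in> {1..l}" by blast
    then have "s x = x"
      using b unfolding blocks_def neighbors_def by metis
    moreover obtain y where "y \<in> {1..N} - {1..l}" "y = s x \<or> x = s y"
      using b x unfolding blocks_def neighbors_def by metis
    ultimately show False
      using x permutes_inj[OF assms(1)] by (metis DiffD2 injD)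
  qed
next
  assume d: "s ` {1..l} \<inter> {1..l} = {}"
  have "s x \<in> {1..N} - {1..l}" if "x \<in> {1..l}" for x
  proof -
    have "s x \<in> {1..N}"
      using that assms permutes_in_image[OF assms(1), of x] by auto
    then show ?thesis
      using that d by blast
  qed
  then show "blocks N l s"
    unfolding blocks_def neighbors_def using d by blast
qed

theorem theorem6p1:
  fixes N l k :: nat
  assumes "l \<ge> 1" and "k \<ge> 1" and "l \<le> N"
  shows "block_prob N l k =
           real (binom (int N - int l) l) / real (binom (int N) l) +
           (-1) ^ (k + 1) * (real (binom (int N - int l - 1) (l - 1)) /
             ((real N - 1) ^ (k - 1) * real (binom (int N) l)))"
\<comment> \<open>For l = N, [N] is its own image, and both binomials in the numerators are 0, the
  second by the convention for a negative upper argument. In the other case N is at least 2, so N -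
  1 is nonzero.\<close>
proof (cases "l = N")
  case True
  have "\<not> blocks N l s" if "s \<in> set_pmf (cycle_product_pmf N k)" for s
  proof -
    note perm = cycle_product_pmf_permutes[OF that]
    show ?thesis
      using blocks_iff_image_disjoint[OF perm assms(3)] permutes_image[OF perm] assms True by auto
  qed
  then have "block_prob N l k = 0"
    unfolding block_prob_def measure_pmf_zero_iff by blast
  then show ?thesis
    using True assms by (simp add: binom_def)
next
  case False
  then have lN: "l < N" using assms by simp
  obtain j where k: "k = Suc j" using assms by (cases k) auto
  define A where "A = {1..l}"
  have A: "A \<subseteq> {1..N}" "card A = l" "A \<noteq> {}" "A \<noteq> {1..N}"
    using assms lN by (auto simp: A_def atLeastatMost_subset_iff)
  \<comment> \<open>The factor common to all image counts, divided by the number of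
    N-cycles.\<close>
  define X :: real where "X = fact (l - 1) * fact (N - l - 1) / fact (N - 1)"
  define P where "P = real ((N - l) choose l)"
  define Q where "Q = real ((N - l - 1) choose (l - 1))"
  define R where "R = real (N choose l)"
  have "block_prob N l k =
      measure_pmf.expectation (cycle_product_pmf N k) (indicator {s. blocks N l s})"
    by (simp add: block_prob_def)
  also have "\<dots> = measure_pmf.expectation (cycle_product_pmf N k) (\<lambda>s. of_bool (s ` A \<inter> A = {}))"
    using blocks_iff_image_disjoint[OF cycle_product_pmf_permutes assms(3)]
    by (intro integral_cong_AE) (auto simp: AE_measure_pmf_iff indicator_def A_def)
  \<comment> \<open>One cycle is split off; j = k - 1 cycles remain in t, and (-1)^j equals
    (-1)^(k+1).\<close>
  also have "\<dots> = X * (real l * P) - X * Q *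
      measure_pmf.expectation (cycle_product_pmf N j) (\<lambda>t. real (card (t ` A - A)))"
    unfolding k expectation_cycle_product_pmf_Suc
  proof (rule expectation_affine_cycle_product_pmf)
    fix t assume t: "t permutes {1..N}"
    have "t ` A \<subseteq> {1..N}" using A permutes_image[OF t] by blast
    moreover have "card (t ` A) = card A"
      using card_image[OF inj_on_subset[OF permutes_inj[OF t]]] by simp
    moreover have "(\<Sum>p\<in>full_cycles N. of_bool ((p \<circ> t) ` A \<inter> A = {}) :: real) =
        real (card {p \<in> cycles_on {1..N}. p ` (t ` A) \<inter> A = {}})"
      by (simp add: full_cycles_eq finite_cycles_on sum.If_cases of_bool_def Int_def image_comp)
    ultimately have "(\<Sum>p\<in>full_cycles N. of_bool ((p \<circ> t) ` A \<inter> A = {}) :: real) =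
        fact (l - 1) * fact (N - l - 1) * (real l * P - real (card (t ` A - A)) * Q)"
      using card_cycles_on_image_disjoint[of "{1..N}" A "t ` A"] A by (simp add: P_def Q_def)
    then show "(\<Sum>p\<in>full_cycles N. of_bool ((p \<circ> t) ` A \<inter> A = {})) / fact (N - 1) =
        X * (real l * P) - X * Q * real (card (t ` A - A))"
      by (simp add: X_def field_simps)
  qed
  also have "\<dots> = X * (real l * P) - X * Q *
      (real l * (real N - real l) / real N * (1 - (-1) ^ j / (real N - 1) ^ j))"
    using expectation_card_image_diff[OF A(1)] A lN assms by simp
  also have "\<dots> = P / R + Q / R * ((-1) ^ j / (real N - 1) ^ j)"
  proof -
    define D where "D = real N - real l"
    have pos: "real l > 0" "D > 0" "R > 0" and N: "real N = real l + D"
      using assms lN by (auto simp: R_def D_def)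
    have "real l * P = real (l * ((N - l) choose l))" by (simp add: P_def)
    \<comment> \<open>The absorption identity, which expresses P through Q.\<close>
    also have "l * ((N - l) choose l) = (N - l) * ((N - l - 1) choose (l - 1))"
      using assms lN times_binomial_minus1_eq[of l "N - l"] by simp
    finally have "real l * P = D * Q"
      using lN by (simp add: Q_def D_def of_nat_diff)
    then have PQ: "P = D * Q / real l"
      using pos by (simp add: field_simps)
    have facts: "fact l = real l * fact (l - 1)" "fact (N - l) = D * fact (N - l - 1)"
      "fact N = real N * (fact (N - 1) :: real)"
      using assms lN by (simp_all add: fact_reduce of_nat_diff D_def)
    have "R = fact N / (fact l * fact (N - l))"
      using lN by (simp add: R_def binomial_fact)
    then have X_eq: "X = real N / (real l * D * R)"
      using pos lN unfolding facts X_def by simp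
    have X: "X * real l = real N / (D * R)"
      using pos unfolding X_eq by simp
    define s :: real where "s = (-1) ^ j / (real N - 1) ^ j"
    have "X * (real l * P) - X * Q * (real l * D / real N * (1 - s)) =
        X * real l * P - X * real l * (Q * D / real N * (1 - s))"
      by (simp add: mult_ac)
    also have "X * real l * P = Q / R * (real N / real l)"
      unfolding X PQ using pos by simp
    \<comment> \<open>The summand 1 cancels against the 1 in \<open>1 - s\<close>, and the factor D
      / l turns Q into P.\<close>
    also have "real N / real l = 1 + D / real l"
      unfolding N using pos by (simp add: add_divide_distrib)
    also have "X * real l * (Q * D / real N * (1 - s)) = Q / R * (1 - s)"
      unfolding X using pos lN by simp
    also have "Q / R * (1 + D / real l) - Q / R * (1 - s) = P / R + Q / R * s"
      unfolding PQ by (simp add: algebra_simps diff_divide_distrib)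
    finally show ?thesis
      unfolding s_def D_def .
  qed
  finally have prob: "block_prob N l k = P / R + Q / R * ((-1) ^ j / (real N - 1) ^ j)" .
  have binom_int: "binom (int m) r = m choose r" for m r
    by (simp add: binom_def)
  have diff: "int (N - l) - 1 = int (N - l - 1)" "int N - int l = int (N - l)"
    using lN by auto
  show ?thesis
    using prob unfolding diff binom_int P_def Q_def R_def k by (simp add: mult_ac)
qed

end
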